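(* A strengthened syllogism is valid if and only if it is provable in the formal system $\mathrm{SYLL}^+$. That is: for every syllogism $P_1,P_2\vdash C$ in the term-variables $S,P,M$ taken together with an existential import assumption "some $X$ exists" for one $X\in\{S,M,P\}$, the syllogism is a valid strengthened syllogism under the assumption on $X$ if and only if it is provable in $\mathrm{SYLL}^+$ with the existential import on $X$.
   Context: **Categorical propositions.** For term-variables $A,B$ there are four categorical propositions with subject $A$ and predicate $B$: $\mathbf{A}_{AB}$ (Each $A$ is $B$), $\mathbf{E}_{AB}$ (No $A$ is $B$), $\mathbf{I}_{AB}$ (Some $A$ is $B$), $\mathbf{O}_{AB}$ (Some $A$ is not $B$). **Syllogisms.** Let $S,P,M$ be three distinct term-variables. A syllogism is an expression $P_1,P_2\vdash C$ with $P_1,P_2,C$ categorical propositions, where the first premise $P_1$ involves exactly $M$ and $P$ (in either order, as subject and predicate), the second premise $P_2$ involves exactly $S$ and $M$ (in either order), and the conclusion $C$ has subject $S$ and predicate $P$. **Valid strengthened syllogisms.** A strengthened syllogism is one considered under existential import, i.e. an explicit assumption of existence of some $S$, $M$ or $P$. The valid ones, with their assumptions, are exactly the following 9: - some $S$ exists: $\mathbf{A}_{MP},\mathbf{A}_{SM}\vdash\mathbf{I}_{SP}$; $\mathbf{A}_{PM},\mathbf{E}_{SM}\vdash\mathbf{O}_{SP}$; $\mathbf{A}_{PM},\mathbf{E}_{MS}\vdash\mathbf{O}_{SP}$; $\mathbf{E}_{MP},\mathbf{A}_{SM}\vdash\mathbf{O}_{SP}$; $\mathbf{E}_{PM},\mathbf{A}_{SM}\vdash\mathbf{O}_{SP}$;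 - some $M$ exists: $\mathbf{A}_{MP},\mathbf{A}_{MS}\vdash\mathbf{I}_{SP}$; $\mathbf{E}_{PM},\mathbf{A}_{MS}\vdash\mathbf{O}_{SP}$; $\mathbf{E}_{MP},\mathbf{A}_{MS}\vdash\mathbf{O}_{SP}$; - some $P$ exists: $\mathbf{A}_{PM},\mathbf{A}_{MS}\vdash\mathbf{I}_{SP}$. **Diagrams.** The syntactic primitives are the symbols $\to$, $\leftarrow$, $\bullet$ and countably many term-variables $A,B,C,\dots$. A diagram is a finite list of arrow symbols ($\to$ or $\leftarrow$) separated by a single bullet or term-variable, beginning and ending at a term-variable (a single term-variable is a diagram). A part of a diagram is a finite list of consecutive components of it; parts are denoted $\mathcal{D},\mathcal{E}$. The categorical propositions are represented by the syllogistic diagrams $$\mathbf{A}_{AB}: A\to B,\quad \mathbf{E}_{AB}: A\to\bullet\leftarrow B,\quad \mathbf{I}_{AB}: A\leftarrow\bullet\to B,\quad \mathbf{O}_{AB}: A\leftarrow\bullet\to\bullet\leftarrow B.$$ The diagram $X\leftarrow\bullet\to X$ of $\mathbf{I}_{XX}$ represents existential import on $X$. **Rules of inference of $\mathrm{SYLL}^+$** (for all term-variables $A,B$ and all parts $\mathcal{D},\mathcal{E}$ such that the expressions are diagrams): 1. from $A\to B$ infer $B\leftarrow A$, and conversely; 2. from $A\to\bullet\leftarrow B$ infer $B\to\bullet\leftarrow A$; 3. from $A\leftarrow\bullet\to B$ infer $B\leftarrow\bullet\to A$; 4. from $A\leftarrow\bullet\to\bullet\leftarrow B$ infer $B\to\bullet\leftarrow\bullet\to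 A$, and conversely; 5. from the two diagrams $\mathcal{D}A$ and $A\mathcal{E}$ (in either order) infer the diagram $\mathcal{D}A\mathcal{E}$ obtained by overlapping them on the common extremal $A$; 6. from $\mathcal{D}\to A\to\mathcal{E}$ infer $\mathcal{D}\to\mathcal{E}$; 7. from $\mathcal{D}\leftarrow A\leftarrow\mathcal{E}$ infer $\mathcal{D}\leftarrow\mathcal{E}$; 8. (the rule added to SYLL) from no hypotheses infer $A\leftarrow\bullet\to A$. **Provability.** A proof tree is a tree in which each node is a diagram and each branching is an instance of a rule of inference. A syllogism is provable in $\mathrm{SYLL}^+$ with the existential import on $X$ if there is a proof tree whose root is the syllogistic diagram of its conclusion and whose topmost diagrams are the syllogistic diagrams of its two premises together with one instance $X\leftarrow\bullet\to X$ of rule 8. *)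

theory Defs
  imports Main "HOL-Library.Multiset"
begin

type_synonym tvar = nat

datatype catprop =
    A_prop (subj: tvar) (pred: tvar)
  | E_prop (subj: tvar) (pred: tvar)
  | I_prop (subj: tvar) (pred: tvar)
  | O_prop (subj: tvar) (pred: tvar)

definition is_syllogism ::
  "tvar \<Rightarrow> tvar \<Rightarrow> tvar \<Rightarrow> catprop \<Rightarrow> catprop \<Rightarrow> catprop \<Rightarrow> bool" where
  "is_syllogism S P M P1 P2 C \<longleftrightarrow>
     distinct [S, P, M] \<and>
     {subj P1, pred P1} = {M, P} \<and>
     {subj P2, pred P2} = {S, M} \<and>
     subj C = S \<and> pred C = P"

(* The fourth argument of valid_strengthened is the term-variable assumed to be non-empty. *)
inductive valid_strengthened ::
  "tvar \<Rightarrow> tvar \<Rightarrow> tvar \<Rightarrow> tvar \<Rightarrow> catprop \<Rightarrow> catprop \<Rightarrow> catprop \<Rightarrow> bool"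
  for S P M where
  "valid_strengthened S P M S (A_prop M P) (A_prop S M) (I_prop S P)"
| "valid_strengthened S P M S (A_prop P M) (E_prop S M) (O_prop S P)"
| "valid_strengthened S P M S (A_prop P M) (E_prop M S) (O_prop S P)"
| "valid_strengthened S P M S (E_prop M P) (A_prop S M) (O_prop S P)"
| "valid_strengthened S P M S (E_prop P M) (A_prop S M) (O_prop S P)"
| "valid_strengthened S P M M (A_prop M P) (A_prop M S) (I_prop S P)"
| "valid_strengthened S P M M (E_prop P M) (A_prop M S) (O_prop S P)"
| "valid_strengthened S P M M (E_prop M P) (A_prop M S) (O_prop S P)"
| "valid_strengthened S P M P (A_prop P M) (A_prop M S) (I_prop S P)"

datatype component =
    To (\<open>\<rightarrow>\<close>)
  | From (\<open>\<leftarrow>\<close>)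
  | Bullet (\<open>\<bullet>\<close>)
  | is_var: Var tvar

definition is_arrow :: "component \<Rightarrow> bool" where
  "is_arrow c \<longleftrightarrow> c = \<rightarrow> \<or> c = \<leftarrow>"

type_synonym diagram = "component list"

definition is_diagram :: "diagram \<Rightarrow> bool" where
  "is_diagram d \<longleftrightarrow>
     d \<noteq> [] \<and> is_var (hd d) \<and> is_var (last d) \<and>
     (\<forall>i < length d. is_arrow (d ! i) \<longleftrightarrow> odd i)"

fun diagram_of :: "catprop \<Rightarrow> diagram" where
  "diagram_of (A_prop A B) = [Var A, \<rightarrow>, Var B]"
| "diagram_of (E_prop A B) = [Var A, \<rightarrow>, \<bullet>, \<leftarrow>, Var B]"
| "diagram_of (I_prop A B) = [Var A, \<leftarrow>, \<bullet>, \<rightarrow>, Var B]"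
| "diagram_of (O_prop A B) = [Var A, \<leftarrow>, \<bullet>, \<rightarrow>, \<bullet>, \<leftarrow>, Var B]"

(* infers hs d: the diagrams hs, in this order, yield d by one rule of SYLL+.
   The parts D, E range over arbitrary lists; the is_diagram conditions restrict them. *)
inductive infers :: "diagram list \<Rightarrow> diagram \<Rightarrow> bool" where
  rule1: "infers [[Var A, \<rightarrow>, Var B]] [Var B, \<leftarrow>, Var A]"
| rule1_conv: "infers [[Var B, \<leftarrow>, Var A]] [Var A, \<rightarrow>, Var B]"
| rule2: "infers [[Var A, \<rightarrow>, \<bullet>, \<leftarrow>, Var B]] [Var B, \<rightarrow>, \<bullet>, \<leftarrow>, Var A]"
| rule3: "infers [[Var A, \<leftarrow>, \<bullet>, \<rightarrow>, Var B]] [Var B, \<leftarrow>, \<bullet>, \<rightarrow>, Var A]"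
| rule4: "infers [[Var A, \<leftarrow>, \<bullet>, \<rightarrow>, \<bullet>, \<leftarrow>, Var B]]
                 [Var B, \<rightarrow>, \<bullet>, \<leftarrow>, \<bullet>, \<rightarrow>, Var A]"
| rule4_conv: "infers [[Var B, \<rightarrow>, \<bullet>, \<leftarrow>, \<bullet>, \<rightarrow>, Var A]]
                 [Var A, \<leftarrow>, \<bullet>, \<rightarrow>, \<bullet>, \<leftarrow>, Var B]"
| rule5: "infers [D @ [Var A], [Var A] @ E] (D @ [Var A] @ E)"
    if "is_diagram (D @ [Var A])" "is_diagram ([Var A] @ E)" "is_diagram (D @ [Var A] @ E)"
| rule5_swap: "infers [[Var A] @ E, D @ [Var A]] (D @ [Var A] @ E)"
    if "is_diagram (D @ [Var A])" "is_diagram ([Var A] @ E)" "is_diagram (D @ [Var A] @ E)"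
| rule6: "infers [D @ [\<rightarrow>, Var A, \<rightarrow>] @ E] (D @ [\<rightarrow>] @ E)"
    if "is_diagram (D @ [\<rightarrow>, Var A, \<rightarrow>] @ E)" "is_diagram (D @ [\<rightarrow>] @ E)"
| rule7: "infers [D @ [\<leftarrow>, Var A, \<leftarrow>] @ E] (D @ [\<leftarrow>] @ E)"
    if "is_diagram (D @ [\<leftarrow>, Var A, \<leftarrow>] @ E)" "is_diagram (D @ [\<leftarrow>] @ E)"
| rule8: "infers [] [Var A, \<leftarrow>, \<bullet>, \<rightarrow>, Var A]"

(* A leaf is either an assumed diagram (Premise d) or a rule application without any
   children (Infer d []), which can only be an instance of rule 8. *)
datatype proof_tree =
    Premise (root: diagram)
  | Infer (root: diagram) "proof_tree list"

fun is_proof_tree :: "proof_tree \<Rightarrow> bool" where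
  "is_proof_tree (Premise d) \<longleftrightarrow> is_diagram d"
| "is_proof_tree (Infer d ts) \<longleftrightarrow>
     infers (map root ts) d \<and> (\<forall>t \<in> set ts. is_proof_tree t)"

(* Topmost diagrams are counted with multiplicity. *)
fun hypotheses :: "proof_tree \<Rightarrow> diagram multiset" where
  "hypotheses (Premise d) = {#d#}"
| "hypotheses (Infer d ts) = sum_list (map hypotheses ts)"

fun rule8_instances :: "proof_tree \<Rightarrow> diagram multiset" where
  "rule8_instances (Premise d) = {#}"
| "rule8_instances (Infer d ts) =
     (if ts = [] then {#d#} else sum_list (map rule8_instances ts))"

definition provable_SYLL_plus ::
  "tvar \<Rightarrow> catprop \<Rightarrow> catprop \<Rightarrow> catprop \<Rightarrow> bool" where
  "provable_SYLL_plus X P1 P2 C \<longleftrightarrow>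
     (\<exists>t. is_proof_tree t \<and> root t = diagram_of C \<and>
          hypotheses t = {#diagram_of P1, diagram_of P2#} \<and>
          rule8_instances t = {#diagram_of (I_prop X X)#})"

end

theory Submission imports Defs begin

text \<open>
  Soundness rests on two quantities that every rule with premises carries additively from the
  premises to the conclusion: the number of bullets, and for each term-variable the number of
  arrows entering it minus the number of arrows leaving it. (Rules 6 and 7 remove one arrow end of
  each kind at \<open>A\<close>; reversing a diagram leaves the direction of its arrows unchanged.) Since the
  premises and the import \<open>X \<leftarrow> \<bullet> \<rightarrow> X\<close> are used exactly once, these quantities for the conclusion
  are the sums of those of the three topmost diagrams, and only the nine valid strengthened
  syllogisms satisfy these equations. Conversely, each of the nine is derived by
  composing the import with the premises.
\<close>

text \<open>A node without children is an instance of rule 8, so \<open>hs \<noteq> []\<close>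
  exempts only leaves counted by \<open>rule8_instances\<close>; at every other node the values of
  the children add up.\<close>

lemma additive_root:
  fixes f :: "diagram \<Rightarrow> 'b :: comm_monoid_add"
  assumes additive: "\<And>hs d. infers hs d \<Longrightarrow> hs \<noteq> [] \<Longrightarrow> f d = sum_list (map f hs)"
    and "is_proof_tree t"
  shows "f (root t) = (\<Sum>d\<in>#hypotheses t + rule8_instances t. f d)"
  using assms(2)
proof (induction t)
  case (Premise d)
  then show ?case by simp
next
  case (Infer d ts)
  show ?case
  proof (cases "ts = []")
    case False
    have "f d = sum_list (map (\<lambda>t. f (root t)) ts)"
      using additive[of "map root ts" d] Infer.prems False by (simp add: comp_def)
    also have "\<dots> = sum_list (map (\<lambda>t. \<Sum>d\<in>#hypotheses t + rule8_instances t. f d) ts)"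
      using Infer by (intro arg_cong[where f = sum_list] map_cong) auto
    also have "\<dots> = (\<Sum>d\<in>#sum_list (map hypotheses ts) + sum_list (map rule8_instances ts). f d)"
      by (induction ts) (auto simp: ac_simps)
    finally show ?thesis using False by simp
  qed simp
qed

lemma infers_bullets:
  "infers hs d \<Longrightarrow> hs \<noteq> [] \<Longrightarrow> count_list d \<bullet> = sum_list (map (\<lambda>h. count_list h \<bullet>) hs)"
  by (induction rule: infers.induct) auto

text \<open>Scoring adjacent pairs rather than whole arrows means that no score is lost when a
  diagram is cut at any shared component, even at an arrow.\<close>

fun arrow_end :: "tvar \<Rightarrow> component \<Rightarrow> component \<Rightarrow> int" where
  "arrow_end v (Var a) \<rightarrow> = (if a = v then -1 else 0)"
| "arrow_end v (Var a) \<leftarrow> = (if a = v then 1 else 0)"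
| "arrow_end v \<rightarrow> (Var a) = (if a = v then 1 else 0)"
| "arrow_end v \<leftarrow> (Var a) = (if a = v then -1 else 0)"
| "arrow_end v _ _ = 0"

fun arrow_balance :: "tvar \<Rightarrow> diagram \<Rightarrow> int" where
  "arrow_balance v (x # y # d) = arrow_end v x y + arrow_balance v (y # d)"
| "arrow_balance v _ = 0"

lemma arrow_balance_overlap:
  "arrow_balance v (D @ x # E) = arrow_balance v (D @ [x]) + arrow_balance v (x # E)"
  by (induction v D rule: arrow_balance.induct) (cases E; simp)+

lemma infers_arrow_balance:
  "infers hs d \<Longrightarrow> hs \<noteq> [] \<Longrightarrow> arrow_balance v d = sum_list (map (arrow_balance v) hs)"
proof (induction rule: infers.induct)
  case (rule5 D A E)
  show ?case using arrow_balance_overlap[of v D "Var A" E] by simp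
next
  case (rule5_swap D A E)
  show ?case using arrow_balance_overlap[of v D "Var A" E] by simp
next
  case (rule6 D A E)
  \<comment> \<open>Once both diagrams are cut at an arrow, they differ only in the two pairs around
    \<open>Var A\<close>, which score +1 and -1 at \<open>A\<close>.\<close>
  show ?case
    using arrow_balance_overlap[of v D "\<rightarrow>" E] arrow_balance_overlap[of v D "\<rightarrow>" "Var A # \<rightarrow> # E"]
    by simp
next
  case (rule7 D A E)
  show ?case
    using arrow_balance_overlap[of v D "\<leftarrow>" E] arrow_balance_overlap[of v D "\<leftarrow>" "Var A # \<leftarrow> # E"]
    by simp
qed auto

lemma provable_imp_valid:
  assumes syll: "is_syllogism S P M P1 P2 C" and X: "X \<in> {S, M, P}"
    and "provable_SYLL_plus X P1 P2 C"
  shows "valid_strengthened S P M X P1 P2 C"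
proof -
  obtain t where t: "is_proof_tree t" "root t = diagram_of C"
      "hypotheses t = {#diagram_of P1, diagram_of P2#}"
      "rule8_instances t = {#diagram_of (I_prop X X)#}"
    using assms(3) unfolding provable_SYLL_plus_def by blast
  have bullets: "count_list (diagram_of C) \<bullet> =
      count_list (diagram_of P1) \<bullet> + count_list (diagram_of P2) \<bullet> + 1"
    using additive_root[OF infers_bullets t(1)] t by simp
  \<comment> \<open>Both arrows of the import enter \<open>X\<close>, hence the 2.\<close>
  have balance: "arrow_balance v (diagram_of C) = arrow_balance v (diagram_of P1) +
      arrow_balance v (diagram_of P2) + (if X = v then 2 else 0)" for v
    using additive_root[OF infers_arrow_balance t(1), of v] t by simp
  \<comment> \<open>Forms A, E, I, O have 0, 1, 1, 2 bullets and balances summing to 0, -2, 2, 0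
    over \<open>S\<close>, \<open>P\<close>, \<open>M\<close>. This leaves only A, A giving I, and A
    with E giving O; the separate balances then fix the orientation of the A premises and
    \<open>X\<close>.\<close>
  show ?thesis
    using syll X bullets balance[of S] balance[of P] balance[of M]
    by (cases P1; cases P2; cases C)
       (auto simp: is_syllogism_def doubleton_eq_iff intro: valid_strengthened.intros)
qed

text \<open>Generalises provability to arbitrary leaves, so that partial derivations can be composed
  with an exact count of what they use.\<close>

definition derives :: "diagram multiset \<Rightarrow> diagram multiset \<Rightarrow> diagram \<Rightarrow> bool" where
  "derives H R d \<longleftrightarrow>
     (\<exists>t. is_proof_tree t \<and> root t = d \<and> hypotheses t = H \<and> rule8_instances t = R)"

lemma provable_SYLL_plus_iff_derives:
  "provable_SYLL_plus X P1 P2 C \<longleftrightarrow>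
     derives {#diagram_of P1, diagram_of P2#} {#diagram_of (I_prop X X)#} (diagram_of C)"
  by (simp add: provable_SYLL_plus_def derives_def)

lemma derives_premise: "is_diagram d \<Longrightarrow> derives {#d#} {#} d"
  unfolding derives_def by (rule exI[of _ "Premise d"]) simp

lemma derives_import: "derives {#} {#diagram_of (I_prop A A)#} (diagram_of (I_prop A A))"
  unfolding derives_def by (rule exI[of _ "Infer (diagram_of (I_prop A A)) []"]) (simp add: rule8)

lemma derives_unary:
  assumes "derives H R d" "infers [d] e"
  shows "derives H R e"
proof -
  obtain t where "is_proof_tree t" "root t = d" "hypotheses t = H" "rule8_instances t = R"
    using assms(1) by (auto simp: derives_def)
  with assms(2) show ?thesis
    unfolding derives_def by (intro exI[of _ "Infer e [t]"]) simp
qed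

lemma derives_binary:
  assumes "derives H R d" "derives H' R' d'" "infers [d, d'] e"
  shows "derives (H + H') (R + R') e"
proof -
  obtain t t' where "is_proof_tree t" "root t = d" "hypotheses t = H" "rule8_instances t = R"
      "is_proof_tree t'" "root t' = d'" "hypotheses t' = H'" "rule8_instances t' = R'"
    using assms(1,2) by (auto simp: derives_def)
  with assms(3) show ?thesis
    unfolding derives_def by (intro exI[of _ "Infer e [t, t']"]) simp
qed

text \<open>\<open>All_less_Suc2\<close> peels off one index at a time, which decides
  \<open>is_diagram\<close> for explicit lists.\<close>

lemmas is_diagram_simps = is_diagram_def is_arrow_def All_less_Suc2

lemma is_diagram_diagram_of: "is_diagram (diagram_of C)"
  by (cases C) (simp_all add: is_diagram_simps)

lemma derives_catprop: "derives {#diagram_of C#} {#} (diagram_of C)"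
  by (rule derives_premise) (rule is_diagram_diagram_of)

lemma derives_E_sym: "derives H R (diagram_of (E_prop A B)) \<Longrightarrow> derives H R (diagram_of (E_prop B A))"
  by (erule derives_unary) (simp add: rule2)

lemma derives_I_sym: "derives H R (diagram_of (I_prop A B)) \<Longrightarrow> derives H R (diagram_of (I_prop B A))"
  by (erule derives_unary) (simp add: rule3)

text \<open>Overlap at \<open>B\<close>, then rule 6 erases \<open>B\<close> between two arrows
  pointing right.\<close>

lemma derives_I_A:
  assumes "derives H R (diagram_of (I_prop A B))" "derives H' R' (diagram_of (A_prop B C))"
  shows "derives (H + H') (R + R') (diagram_of (I_prop A C))"
proof -
  have "derives (H + H') (R + R') [Var A, \<leftarrow>, \<bullet>, \<rightarrow>, Var B, \<rightarrow>, Var C]"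
    using rule5[of "[Var A, \<leftarrow>, \<bullet>, \<rightarrow>]" B "[\<rightarrow>, Var C]"]
    by (intro derives_binary[OF assms]) (simp add: is_diagram_simps)
  then show ?thesis
    using rule6[of "[Var A, \<leftarrow>, \<bullet>]" B "[Var C]"]
    by (elim derives_unary) (simp add: is_diagram_simps)
qed

lemma derives_I_E:
  assumes "derives H R (diagram_of (I_prop A B))" "derives H' R' (diagram_of (E_prop B C))"
  shows "derives (H + H') (R + R') (diagram_of (O_prop A C))"
proof -
  have "derives (H + H') (R + R') [Var A, \<leftarrow>, \<bullet>, \<rightarrow>, Var B, \<rightarrow>, \<bullet>, \<leftarrow>, Var C]"
    using rule5[of "[Var A, \<leftarrow>, \<bullet>, \<rightarrow>]" B "[\<rightarrow>, \<bullet>, \<leftarrow>, Var C]"]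
    by (intro derives_binary[OF assms]) (simp add: is_diagram_simps)
  then show ?thesis
    using rule6[of "[Var A, \<leftarrow>, \<bullet>]" B "[\<bullet>, \<leftarrow>, Var C]"]
    by (elim derives_unary) (simp add: is_diagram_simps)
qed

text \<open>Rule 1 turns the A premise round so that it starts at \<open>B\<close>; after the
  overlap rule 7 erases \<open>B\<close>.\<close>

lemma derives_O_A:
  assumes "derives H R (diagram_of (O_prop A B))" "derives H' R' (diagram_of (A_prop C B))"
  shows "derives (H + H') (R + R') (diagram_of (O_prop A C))"
proof -
  have "derives H' R' [Var B, \<leftarrow>, Var C]"
    using assms(2) by (rule derives_unary) (simp add: rule1)
  then have "derives (H + H') (R + R') [Var A, \<leftarrow>, \<bullet>, \<rightarrow>, \<bullet>, \<leftarrow>, Var B, \<leftarrow>, Var C]"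
    using rule5[of "[Var A, \<leftarrow>, \<bullet>, \<rightarrow>, \<bullet>, \<leftarrow>]" B "[\<leftarrow>, Var C]"]
    by (intro derives_binary[OF assms(1)]) (simp_all add: is_diagram_simps)
  then show ?thesis
    using rule7[of "[Var A, \<leftarrow>, \<bullet>, \<rightarrow>, \<bullet>]" B "[Var C]"]
    by (elim derives_unary) (simp add: is_diagram_simps)
qed

lemma valid_imp_provable:
  "valid_strengthened S P M X P1 P2 C \<Longrightarrow> provable_SYLL_plus X P1 P2 C"
  unfolding provable_SYLL_plus_iff_derives
proof (induction rule: valid_strengthened.induct)
  case 1
  \<comment> \<open>The second premise extends the import first, hence
    \<open>add_mset_commute\<close>.\<close>
  show ?case
    using derives_I_A[OF derives_I_A[OF derives_import derives_catprop] derives_catprop, of S M P]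
    by (simp add: add_mset_commute)
next
  case 2
  show ?case
    using derives_O_A[OF derives_I_E[OF derives_import derives_catprop] derives_catprop, of S M P]
    by (simp add: add_mset_commute)
next
  case 3
  show ?case
    using derives_O_A[OF derives_I_E[OF derives_import derives_E_sym[OF derives_catprop]]
        derives_catprop, of M S P]
    by (simp add: add_mset_commute)
next
  case 4
  show ?case
    using derives_I_E[OF derives_I_A[OF derives_import derives_catprop] derives_catprop, of S M P]
    by (simp add: add_mset_commute)
next
  case 5
  show ?case
    using derives_I_E[OF derives_I_A[OF derives_import derives_catprop]
        derives_E_sym[OF derives_catprop], of S M P]
    by (simp add: add_mset_commute)
next
  case 6
  \<comment> \<open>The import on \<open>M\<close> grows to I from \<open>M\<close> to
    \<open>S\<close>; the flip exposes the end \<open>M\<close> to the first premise.\<close>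
  show ?case
    using derives_I_A[OF derives_I_sym[OF derives_I_A[OF derives_import derives_catprop]]
        derives_catprop, of M S P]
    by (simp add: add_mset_commute)
next
  case 7
  show ?case
    using derives_I_E[OF derives_I_sym[OF derives_I_A[OF derives_import derives_catprop]]
        derives_E_sym[OF derives_catprop], of M S P]
    by (simp add: add_mset_commute)
next
  case 8
  show ?case
    using derives_I_E[OF derives_I_sym[OF derives_I_A[OF derives_import derives_catprop]]
        derives_catprop, of M S P]
    by (simp add: add_mset_commute)
next
  case 9
  show ?case
    using derives_I_sym[OF derives_I_A[OF derives_I_A[OF derives_import derives_catprop]
        derives_catprop], of P M S]
    by (simp add: add_mset_commute)
qed

theorem theorem3p18:
  fixes S P M X :: tvar and P1 P2 C :: catprop
  assumes "is_syllogism S P M P1 P2 C"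
    and "X \<in> {S, M, P}"
  shows "valid_strengthened S P M X P1 P2 C \<longleftrightarrow> provable_SYLL_plus X P1 P2 C"
  using provable_imp_valid[OF assms] valid_imp_provable by blast

end
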